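(* Let $f\in\mathcal{C}$ be a substantially transitive map and let $\lambda>2$. Assume that there exist $\delta>0$, an infinite measure $\mu\in\mathcal{M}$ (i.e. $\mu([0,1])=\infty$), and an $f$-admissible set $P$, such that $T_f\mu=\lambda\mu$ and the measure of every $P$-basic interval $I$ satisfies $\delta\le\mu(I)<\infty$. Then there is no probability measure $\nu\in\mathcal{M}$ such that $T_f\nu=\lambda\nu$.
   Context: If $P$ is a closed countable subset of $[0,1]$, a connected component of $[0,1]\setminus P$ is called a $P$-basic interval; the set of all of them is $\mathcal{B}(P)$. $\mathcal{C}$ is the class of maps $f$ for which there is a closed countable set $P\subset[0,1]$ such that $f:[0,1]\setminus P\to[0,1]$ and $f$ is continuous and strictly monotone on each $P$-basic interval. Two elements of $\mathcal{C}$ are considered equal if they agree on the complement of a closed countable set; a closed countable set $P$ is called $f$-admissible if $f$ is continuous and strictly monotone on each $P$-basic interval. The class $\mathcal{C}$ is closed under composition (where the composition is defined off a closed countable set), so iterates $f^n$ are in $\mathcal{C}$. $\mathcal{M}$ is the set of all nonatomic measures $\mu$ on the Borel $\sigma$-algebra of $[0,1]$ that are strongly $\sigma$-finite, i.e. there is a closed countable set $P\subset[0,1]$ such that each $P$-basic interval has finite $\mu$-measure. For $f\in\mathcal{C}$ the operator $T_f:\mathcal{M}\to\mathcal{M}$ is defined by choosing an $f$-admissible set $P$ and setting $(T_f\mu)(A)=\sum_{I\in\mathcal{B}(P)}\mu(f(I\cap A))$ for all Borel sets $A$; it does not depend on the choice of $P$. A map $f\in\mathcal{C}$ is substantially transitive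 if for every nonempty open set $U\subset[0,1]$ the set $[0,1]\setminus\bigcup_{n=0}^\infty f^n(U)$ is countable (here $f^n(U)$ is the image of those points of $U$ at which $f^n$ is defined). *)

theory Defs
  imports "HOL-Analysis.Analysis" "HOL-Probability.Probability_Measure"
begin

definition closed_countable :: "real set \<Rightarrow> bool" where
  "closed_countable P \<longleftrightarrow> closed P \<and> countable P \<and> P \<subseteq> {0..1}"

definition basic_intervals :: "real set \<Rightarrow> real set set" where
  "basic_intervals P = components ({0..1} - P)"

text \<open>Elements of the class C are represented by partial maps of the reals, so that
  the domain of a map, of a composition and of an iterate is part of the data.
  \<open>pw_monotone f P\<close> says that the domain of \<open>f\<close> is exactly the complement of \<open>P\<close>.\<close>

definition pw_monotone :: "(real \<rightharpoonup> real) \<Rightarrow> real set \<Rightarrow> bool" where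
  "pw_monotone f P \<longleftrightarrow>
     closed_countable P \<and> dom f = {0..1} - P \<and> ran f \<subseteq> {0..1} \<and>
     (\<forall>I \<in> basic_intervals P. continuous_on I (\<lambda>x. the (f x)) \<and>
        (strict_mono_on I (\<lambda>x. the (f x)) \<or> strict_antimono_on I (\<lambda>x. the (f x))))"

definition class_C :: "(real \<rightharpoonup> real) set" where
  "class_C = {f. \<exists>P. pw_monotone f P}"

text \<open>Equality of two elements of the class C.\<close>

definition eq_C :: "(real \<rightharpoonup> real) \<Rightarrow> (real \<rightharpoonup> real) \<Rightarrow> bool" where
  "eq_C f g \<longleftrightarrow> (\<exists>D. closed_countable D \<and> (\<forall>x \<in> {0..1} - D. f x = g x))"

text \<open>Admissibility is a property of the element of the class C, not of the chosen
  representative: \<open>P\<close> need not contain the points where the given representative happens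
  to be undefined, as long as some equal map is defined and piecewise monotone off \<open>P\<close>.
  Every \<open>P\<close> that works for \<open>f\<close> itself (take for \<open>g\<close> the restriction of \<open>f\<close>)
  is covered.\<close>

definition admissible :: "(real \<rightharpoonup> real) \<Rightarrow> real set \<Rightarrow> bool" where
  "admissible f P \<longleftrightarrow> (\<exists>g. eq_C f g \<and> pw_monotone g P)"

definition pimage :: "(real \<rightharpoonup> real) \<Rightarrow> real set \<Rightarrow> real set" where
  "pimage f S = ran (f |` S)"

text \<open>The zeroth iterate is the identity; it is only ever applied inside the unit interval.\<close>

primrec iterate :: "(real \<rightharpoonup> real) \<Rightarrow> nat \<Rightarrow> (real \<rightharpoonup> real)" where
  "iterate f 0 = Some"
| "iterate f (Suc n) = f \<circ>\<^sub>m iterate f n"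

definition substantially_transitive :: "(real \<rightharpoonup> real) \<Rightarrow> bool" where
  "substantially_transitive f \<longleftrightarrow>
     (\<forall>U. openin (top_of_set {0..1}) U \<and> U \<noteq> {} \<longrightarrow>
        countable ({0..1} - (\<Union>n. pimage (iterate f n) U)))"

definition atom :: "'a measure \<Rightarrow> 'a set \<Rightarrow> bool" where
  "atom \<mu> A \<longleftrightarrow> A \<in> sets \<mu> \<and> 0 < emeasure \<mu> A \<and>
     (\<forall>B \<in> sets \<mu>. B \<subseteq> A \<and> emeasure \<mu> B < emeasure \<mu> A \<longrightarrow> emeasure \<mu> B = 0)"

definition nonatomic :: "'a measure \<Rightarrow> bool" where
  "nonatomic \<mu> \<longleftrightarrow> (\<nexists>A. atom \<mu> A)"

definition strongly_sigma_finite :: "real measure \<Rightarrow> bool" where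
  "strongly_sigma_finite \<mu> \<longleftrightarrow>
     (\<exists>P. closed_countable P \<and> (\<forall>I \<in> basic_intervals P. emeasure \<mu> I < \<infinity>))"

definition class_M :: "real measure set" where
  "class_M = {\<mu>. sets \<mu> = sets (restrict_space borel {0..1}) \<and>
                 nonatomic \<mu> \<and> strongly_sigma_finite \<mu>}"

definition T_op :: "(real \<rightharpoonup> real) \<Rightarrow> real measure \<Rightarrow> real measure" where
  "T_op f \<mu> = measure_of {0..1} (sets (restrict_space borel {0..1}))
     (\<lambda>A. \<Sum>\<^sub>\<infinity>I \<in> basic_intervals (SOME P. admissible f P). emeasure \<mu> (pimage f (I \<inter> A)))"

text \<open>The constant \<open>measure_of\<close> yields the null measure when the given set function is not
  a measure. The rest of this theory shows that this does not happen here and that the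
  choice of the admissible set is irrelevant. The latter is seen by comparison with the
  Banach indicatrix.\<close>

lemma infsum_ennreal_eq_nn_integral:
  fixes h :: "'a \<Rightarrow> ennreal"
  shows "infsum h S = (\<integral>\<^sup>+x. h x \<partial>count_space S)"
proof -
  have "infsum h S = (SUP F\<in>{F. finite F \<and> F \<subseteq> S}. sum h F)"
    by (rule nonneg_infsum_complete) auto
  also have "\<dots> = (\<integral>\<^sup>+x. h x \<partial>count_space S)"
  proof (rule antisym)
    show "(SUP F\<in>{F. finite F \<and> F \<subseteq> S}. sum h F) \<le> (\<integral>\<^sup>+x. h x \<partial>count_space S)"
    proof (rule SUP_least)
      fix F assume "F \<in> {F. finite F \<and> F \<subseteq> S}"
      then have F: "finite F" "F \<subseteq> S" by auto
      have "sum h F = (\<integral>\<^sup>+x. h x \<partial>count_space F)"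
        using F(1) by (simp add: nn_integral_count_space_finite)
      also have "\<dots> = (\<integral>\<^sup>+x. h x * indicator F x \<partial>count_space S)"
        using F(2) by (simp add: nn_integral_count_space_indicator nn_integral_count_space_indicator[of S]
            mult.assoc) (auto intro!: nn_integral_cong simp: indicator_def)
      also have "\<dots> \<le> (\<integral>\<^sup>+x. h x \<partial>count_space S)"
        by (intro nn_integral_mono) (auto simp: indicator_def)
      finally show "sum h F \<le> (\<integral>\<^sup>+x. h x \<partial>count_space S)" .
    qed
    show "(\<integral>\<^sup>+x. h x \<partial>count_space S) \<le> (SUP F\<in>{F. finite F \<and> F \<subseteq> S}. sum h F)"
      unfolding nn_integral_def
    proof (rule SUP_least)
      fix s assume s: "s \<in> {g. simple_function (count_space S) g \<and> g \<le> h}"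
      then have sf: "simple_function (count_space S) s" and le: "s \<le> h" by auto
      let ?U = "SUP F\<in>{F. finite F \<and> F \<subseteq> S}. sum h F"
      show "integral\<^sup>S (count_space S) s \<le> ?U"
      proof (cases "finite {x\<in>S. s x \<noteq> 0}")
        case True
        have "integral\<^sup>S (count_space S) s = (\<integral>\<^sup>+x. s x \<partial>count_space S)"
          using sf by (simp add: nn_integral_eq_simple_integral)
        also have "\<dots> = (\<Sum>x | x \<in> S \<and> s x \<noteq> 0. s x)"
          using True by (subst nn_integral_count_space) (auto simp: zero_less_iff_neq_zero)
        also have "\<dots> \<le> (\<Sum>x | x \<in> S \<and> s x \<noteq> 0. h x)"
          using le by (intro sum_mono) (auto simp: le_fun_def)
        also have "\<dots> \<le> ?U"
          using True by (intro SUP_upper) auto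
        finally show ?thesis .
      next
        case False
        have "finite (s ` S)" using sf by (auto simp: simple_function_def)
        then have "finite (s ` {x\<in>S. s x \<noteq> 0})" by (rule finite_subset[rotated]) auto
        then obtain c where c: "c \<in> {x\<in>S. s x \<noteq> 0}"
          "infinite {a\<in>{x\<in>S. s x \<noteq> 0}. s a = s c}"
          using pigeonhole_infinite[OF False] by blast
        have "?U = \<infinity>"
        proof (rule ccontr)
          assume "?U \<noteq> \<infinity>"
          then have lt: "?U < \<infinity>" by (metis infinity_ennreal_def top.not_eq_extremum)
          have sc: "0 < s c" using c(1) by (simp add: zero_less_iff_neq_zero)
          have "of_nat n * s c \<le> ?U" for n
          proof -
            obtain F where F: "finite F" "card F = n" "F \<subseteq> {a\<in>{x\<in>S. s x \<noteq> 0}. s a = s c}"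
              using infinite_arbitrarily_large[OF c(2), of n] by blast
            have "of_nat n * s c = sum s F" using F by (subst sum.cong[of F F s "\<lambda>_. s c"]) auto
            also have "\<dots> \<le> sum h F" using le by (intro sum_mono) (auto simp: le_fun_def)
            also have "\<dots> \<le> ?U" using F by (intro SUP_upper) auto
            finally show ?thesis .
          qed
          then have "(SUP n. of_nat n * s c) \<le> ?U" by (intro SUP_least)
          moreover have "(SUP n. of_nat n * s c) = (SUP n. of_nat n) * s c"
            by (rule SUP_mult_right_ennreal[symmetric])
          moreover have "(SUP n. of_nat n) * s c = \<infinity>"
            using sc by (simp add: ennreal_SUP_of_nat_eq_top ennreal_top_mult)
          ultimately show False using lt by simp
        qed
        then show ?thesis by (simp only: infinity_ennreal_def top_greatest)
      qed
    qed
  qed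
  finally show ?thesis .
qed

lemma countable_basic_intervals:
  assumes "closed_countable P"
  shows "countable (basic_intervals P)"
proof -
  have op: "openin (top_of_set {0..1}) ({0..1} - P)"
    using assms by (auto simp: closed_countable_def openin_open Diff_eq)
  have lc: "locally connected ({0..1} - P)"
    by (rule locally_open_subset[OF _ op]) (simp add: convex_imp_locally_connected)
  have "interior C \<noteq> {}" if C: "C \<in> basic_intervals P" for C
  proof -
    have "openin (top_of_set ({0..1} - P)) C"
      using openin_components_locally_connected[OF lc] C by (auto simp: basic_intervals_def)
    then have "openin (top_of_set {0..1}) C" using op openin_trans by blast
    then obtain W where W: "open W" "C = {0..1} \<inter> W" by (auto simp: openin_open)
    obtain x where x: "x \<in> C"
      using C in_components_nonempty unfolding basic_intervals_def by blast
    have "x \<in> closure {0<..<1::real}" using x W by (simp add: closure_greaterThanLessThan)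
    then have "W \<inter> {0<..<1} \<noteq> {}"
      using x W open_Int_closure_eq_empty[of W "{0<..<1}"] by blast
    moreover have "W \<inter> {0<..<1} \<subseteq> interior C"
      using W by (intro interior_maximal) auto
    ultimately show ?thesis by blast
  qed
  moreover have "pairwise disjnt (basic_intervals P)"
    unfolding basic_intervals_def by (simp add: pairwise_disjoint_components disjnt_def
        pairwise_def components_nonoverlap)
  ultimately show ?thesis
    using countable_disjoint_nonempty_interior_subsets by blast
qed

lemma Union_basic_intervals: "\<Union> (basic_intervals P) = {0..1} - P"
  unfolding basic_intervals_def by (rule Union_components)

lemma pimage_iff: "y \<in> pimage f S \<longleftrightarrow> (\<exists>x\<in>S. f x = Some y)"
  by (auto simp: pimage_def ran_def restrict_map_def split: if_splits)

lemma countable_pimage: "countable S \<Longrightarrow> countable (pimage f S)"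
proof -
  assume "countable S"
  moreover have "pimage f S \<subseteq> (\<lambda>x. the (f x)) ` S"
    by (force simp: pimage_iff)
  ultimately show ?thesis by (meson countable_image countable_subset)
qed

lemma pw_monotone_inj:
  assumes "pw_monotone g P" "I \<in> basic_intervals P" "x \<in> I" "x' \<in> I" "g x = g x'"
  shows "x = x'"
proof -
  have "strict_mono_on I (\<lambda>x. the (g x)) \<or> strict_antimono_on I (\<lambda>x. the (g x))"
    using assms by (auto simp: pw_monotone_def)
  then show ?thesis
    using assms(3-5) linorder_less_linear[of x x'] unfolding monotone_on_def by (metis order_less_irrefl)
qed

lemma pw_monotone_defined:
  assumes "pw_monotone g P" "I \<in> basic_intervals P" "x \<in> I"
  shows "\<exists>y. g x = Some y"
proof -
  have "x \<in> {0..1} - P" using assms Union_basic_intervals by blast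
  then show ?thesis using assms(1) by (auto simp: pw_monotone_def)
qed

lemma class_M_countable:
  assumes "\<mu> \<in> class_M" "countable N" "N \<subseteq> {0..1}"
  shows "N \<in> null_sets \<mu>"
proof -
  have s: "sets \<mu> = sets (restrict_space borel {0..1})" and na: "nonatomic \<mu>"
    using assms by (auto simp: class_M_def)
  have m: "B \<in> sets \<mu>" if "countable B" "B \<subseteq> {0..1}" for B
    using that s by (simp add: sets_restrict_space_iff sets.countable)
  have "{x} \<in> null_sets \<mu>" if "x \<in> N" for x
  proof -
    have "{x} \<in> sets \<mu>" using assms that by (intro m) auto
    moreover have "\<not> atom \<mu> {x}" using na by (simp add: nonatomic_def)
    ultimately have "emeasure \<mu> {x} = 0"
      unfolding atom_def by (metis emeasure_empty less_irrefl subset_singletonD zero_less_iff_neq_zero)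
    then show ?thesis using \<open>{x} \<in> sets \<mu>\<close> by auto
  qed
  then have "(\<Union>x\<in>N. {x}) \<in> null_sets \<mu>" using assms(2) by (intro null_sets_UN') auto
  then show ?thesis by simp
qed

lemma pimage_null:
  assumes "\<mu> \<in> class_M" "countable S" "ran h \<subseteq> {0..1}" "E \<subseteq> pimage h S"
  shows "E \<in> null_sets \<mu>"
proof -
  have "pimage h S \<subseteq> ran h" by (auto simp: pimage_iff ran_def)
  then show ?thesis
    using assms countable_subset[OF assms(4) countable_pimage]
    by (intro class_M_countable) auto
qed

lemma mono_image_borel:
  fixes h :: "real \<Rightarrow> real"
  assumes "is_interval I" "continuous_on I h" "strict_mono_on I h" "A \<in> sets borel"
  shows "h ` (I \<inter> A) \<in> sets borel"
proof -
  have inj: "inj_on h I" using assms(3) strict_mono_on_imp_inj_on by blast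
  have "is_interval (h ` I)"
    using assms by (simp add: is_interval_connected_1 connected_continuous_image)
  then have J: "h ` I \<in> sets borel"
    using borel_measurable_indicator real_interval_borel_measurable by blast
  have "mono_on (h ` I) (inv_into I h)"
  proof (rule mono_onI)
    fix r s assume "r \<in> h ` I" "s \<in> h ` I" "r \<le> s"
    then obtain a b where ab: "a \<in> I" "b \<in> I" "r = h a" "s = h b" by auto
    then have "a \<le> b" using \<open>r \<le> s\<close> assms(3)
      by (metis linorder_not_less strict_mono_onD)
    then show "inv_into I h r \<le> inv_into I h s" using ab inj by simp
  qed
  then have "inv_into I h \<in> borel_measurable (restrict_space borel (h ` I))"
    by (rule borel_measurable_mono_on_fnc)
  then have "inv_into I h -` A \<inter> h ` I \<in> sets (restrict_space borel (h ` I))"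
    using measurable_sets[OF _ assms(4), of "inv_into I h" "restrict_space borel (h ` I)"]
    by (simp add: space_restrict_space)
  moreover have "inv_into I h -` A \<inter> h ` I = h ` (I \<inter> A)"
    using inj by (auto simp: image_iff)
  ultimately show ?thesis using J by (simp add: sets_restrict_space_iff)
qed

lemma pimage_borel:
  assumes "pw_monotone g P" "I \<in> basic_intervals P" "A \<in> sets borel"
  shows "pimage g (I \<inter> A) \<in> sets (restrict_space borel {0..1})"
proof -
  let ?h = "\<lambda>x. the (g x)"
  have I: "is_interval I"
    using assms(2) in_components_connected
    by (auto simp: basic_intervals_def is_interval_connected_1)
  have c: "continuous_on I ?h" and m: "strict_mono_on I ?h \<or> strict_antimono_on I ?h"
    using assms by (auto simp: pw_monotone_def)
  have eq: "pimage g (I \<inter> A) = ?h ` (I \<inter> A)"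
    using pw_monotone_defined[OF assms(1,2)] by (force simp: pimage_iff)
  have "?h ` (I \<inter> A) \<in> sets borel"
    using m
  proof
    assume "strict_mono_on I ?h"
    then show ?thesis using mono_image_borel[OF I c _ assms(3)] by blast
  next
    assume a: "strict_antimono_on I ?h"
    have "(\<lambda>x. - ?h x) ` (I \<inter> A) \<in> sets borel"
      using a c I assms(3)
      by (intro mono_image_borel) (auto intro!: continuous_intros simp: monotone_on_def)
    then have "uminus -` ((\<lambda>x. - ?h x) ` (I \<inter> A)) \<inter> space borel \<in> sets borel"
      by (intro measurable_sets[of uminus borel borel]) auto
    moreover have "uminus -` ((\<lambda>x. - ?h x) ` (I \<inter> A)) = ?h ` (I \<inter> A)"
      by (auto simp: image_iff)
    ultimately show ?thesis by simp
  qed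
  moreover have "pimage g (I \<inter> A) \<subseteq> {0..1}"
    using assms(1) by (force simp: pimage_iff pw_monotone_def ran_def)
  ultimately show ?thesis using eq by (simp add: sets_restrict_space_iff)
qed

lemma pimage_eq_C:
  assumes f: "f \<in> class_C" and mu: "\<mu> \<in> class_M"
    and g: "eq_C f g" "pw_monotone g P" and I: "I \<in> basic_intervals P" and A: "A \<in> sets borel"
  shows "emeasure \<mu> (pimage f (I \<inter> A)) = emeasure \<mu> (pimage g (I \<inter> A))"
proof -
  obtain D where D: "closed_countable D" "\<And>x. x \<in> {0..1} - D \<Longrightarrow> f x = g x"
    using g(1) by (auto simp: eq_C_def)
  have sub: "I \<subseteq> {0..1}" using I Union_basic_intervals[of P] by blast
  have rf: "ran f \<subseteq> {0..1}" using f by (auto simp: class_C_def pw_monotone_def)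
  have rg: "ran g \<subseteq> {0..1}" using g by (auto simp: pw_monotone_def)
  have s: "sets \<mu> = sets (restrict_space borel {0..1})" using mu by (simp add: class_M_def)
  have gb: "pimage g (I \<inter> A) \<in> sets \<mu>" using pimage_borel[OF g(2) I A] s by simp
  let ?E = "pimage f (I \<inter> A)" and ?F = "pimage g (I \<inter> A)"
  have d1: "?E - ?F \<subseteq> pimage f D" "?F - ?E \<subseteq> pimage g D"
  proof -
    have "f x = g x \<or> x \<in> D" if "x \<in> I" for x using D(2)[of x] sub that by blast
    then show "?E - ?F \<subseteq> pimage f D" "?F - ?E \<subseteq> pimage g D"
      unfolding subset_iff Diff_iff pimage_iff by (metis Int_iff)+
  qed
  have "countable D" using D(1) by (simp add: closed_countable_def)
  then have nn: "?E - ?F \<in> null_sets \<mu>" "?F - ?E \<in> null_sets \<mu>"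
    using d1 rf rg by (auto intro: pimage_null[OF mu])
  have "?E = (?F - (?F - ?E)) \<union> (?E - ?F)" by auto
  then have "emeasure \<mu> ?E = emeasure \<mu> (?F - (?F - ?E))"
    using nn gb by (metis emeasure_Un_null_set null_setsD2 sets.Diff)
  also have "\<dots> = emeasure \<mu> ?F" using nn gb by (simp add: emeasure_Diff_null_set)
  finally show ?thesis .
qed

lemma T_sum_eq_indicatrix:
  assumes f: "f \<in> class_C" and mu: "\<mu> \<in> class_M" and P: "admissible f P"
    and A: "A \<in> sets (restrict_space borel {0..1})"
  shows "(\<Sum>\<^sub>\<infinity>I \<in> basic_intervals P. emeasure \<mu> (pimage f (I \<inter> A))) =
    (\<integral>\<^sup>+y. emeasure (count_space UNIV) {x\<in>A. f x = Some y} \<partial>\<mu>)"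
proof -
  obtain g where g: "eq_C f g" "pw_monotone g P" using P by (auto simp: admissible_def)
  obtain D where D: "closed_countable D" "\<And>x. x \<in> {0..1} - D \<Longrightarrow> f x = g x"
    using g(1) by (auto simp: eq_C_def)
  have A': "A \<in> sets borel" "A \<subseteq> {0..1}" using A by (auto simp: sets_restrict_space_iff)
  have s: "sets \<mu> = sets (restrict_space borel {0..1})" using mu by (simp add: class_M_def)
  have cP: "closed_countable P" using g by (simp add: pw_monotone_def)
  note cB = countable_basic_intervals[OF cP]
  have rf: "ran f \<subseteq> {0..1}" using f by (auto simp: class_C_def pw_monotone_def)
  have rg: "ran g \<subseteq> {0..1}" using g by (auto simp: pw_monotone_def)
  have gb: "pimage g (I \<inter> A) \<in> sets \<mu>" if "I \<in> basic_intervals P" for I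
    using pimage_borel[OF g(2) that A'(1)] s by simp
  define N where "N = pimage f (D \<union> P) \<union> pimage g (D \<union> P)"
  have "countable (D \<union> P)" using D(1) cP by (auto simp: closed_countable_def)
  then have N: "N \<in> null_sets \<mu>"
    unfolding N_def using rf rg by (intro null_sets.Un pimage_null[OF mu, OF _ _ order_refl]) auto
  have "(\<Sum>\<^sub>\<infinity>I \<in> basic_intervals P. emeasure \<mu> (pimage f (I \<inter> A))) =
      (\<Sum>\<^sub>\<infinity>I \<in> basic_intervals P. emeasure \<mu> (pimage g (I \<inter> A)))"
    using pimage_eq_C[OF f mu g _ A'(1)] by (intro infsum_cong)
  also have "\<dots> = (\<integral>\<^sup>+I. (\<integral>\<^sup>+y. indicator (pimage g (I \<inter> A)) y \<partial>\<mu>) \<partial>count_space (basic_intervals P))"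
    unfolding infsum_ennreal_eq_nn_integral using gb by (intro nn_integral_cong) auto
  also have "\<dots> = (\<integral>\<^sup>+y. (\<integral>\<^sup>+I. indicator (pimage g (I \<inter> A)) y \<partial>count_space (basic_intervals P)) \<partial>\<mu>)"
    using cB gb by (intro nn_integral_count_space_nn_integral[symmetric] | auto)+
  also have "\<dots> = (\<integral>\<^sup>+y. emeasure (count_space UNIV) {x\<in>A. f x = Some y} \<partial>\<mu>)"
  proof (rule nn_integral_cong_AE, rule AE_I'[OF N], clarify, rule ccontr)
    fix y assume ne: "(\<integral>\<^sup>+I. indicator (pimage g (I \<inter> A)) y \<partial>count_space (basic_intervals P))
        \<noteq> emeasure (count_space UNIV) {x\<in>A. f x = Some y}"
    assume yN: "y \<notin> N"
    have key: "f x = Some y \<longleftrightarrow> g x = Some y" if "x \<in> A" for x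
      proof -
      have "f x = g x \<or> x \<in> D" using D(2)[of x] A'(2) that by blast
      then show ?thesis using yN by (auto simp: N_def pimage_iff)
    qed
    let ?X = "{x\<in>A. f x = Some y}" and ?K = "{I \<in> basic_intervals P. y \<in> pimage g (I \<inter> A)}"
    have X: "x \<in> {0..1} - P" if "x \<in> ?X" for x
    proof -
      have "x \<in> A" "f x = Some y" using that by auto
      then show ?thesis using yN A'(2) unfolding N_def Un_iff pimage_iff by blast
    qed
    have ex: "\<forall>x\<in>?X. \<exists>I. I \<in> basic_intervals P \<and> x \<in> I"
      using X Union_basic_intervals[of P] by blast
    then obtain \<iota> where io: "\<And>x. x \<in> ?X \<Longrightarrow> \<iota> x \<in> basic_intervals P \<and> x \<in> \<iota> x" by metis
    have "bij_betw \<iota> ?X ?K"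
    proof (rule bij_betw_imageI)
      show "inj_on \<iota> ?X"
        using io key pw_monotone_inj[OF g(2)] by (intro inj_onI) (smt (verit) mem_Collect_eq)
      show "\<iota> ` ?X = ?K"
      proof (intro equalityI subsetI)
        fix J assume "J \<in> \<iota> ` ?X"
        then show "J \<in> ?K" using io key by (auto simp: pimage_iff)
      next
        fix J assume "J \<in> ?K"
        then obtain x where x: "x \<in> J" "x \<in> A" "g x = Some y" "J \<in> basic_intervals P"
          by (auto simp: pimage_iff)
        then have xX: "x \<in> ?X" using key by auto
        have "\<iota> x = J"
          using io[OF xX] x components_nonoverlap[of "\<iota> x" "{0..1} - P" J]
          by (auto simp: basic_intervals_def)
        then show "J \<in> \<iota> ` ?X" using xX by blast
      qed
    qed
    then have "emeasure (count_space UNIV) ?X = emeasure (count_space UNIV) ?K"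
      by (simp add: emeasure_count_space bij_betw_finite bij_betw_same_card)
    moreover have "(\<integral>\<^sup>+I. indicator (pimage g (I \<inter> A)) y \<partial>count_space (basic_intervals P)) =
        (\<integral>\<^sup>+I. indicator ?K I \<partial>count_space (basic_intervals P))"
      by (intro nn_integral_cong) (auto simp: indicator_def)
    moreover have "\<dots> = emeasure (count_space (basic_intervals P)) ?K"
      by (rule nn_integral_indicator) auto
    moreover have "\<dots> = emeasure (count_space UNIV) ?K"
      by (subst (1 2) emeasure_count_space) auto
    ultimately show False using ne by simp
  qed
  finally show ?thesis .
qed

lemma admissible_exists: "f \<in> class_C \<Longrightarrow> \<exists>P. admissible f P"
  by (auto simp: class_C_def admissible_def eq_C_def pw_monotone_def)

lemma sigma_algebra_unit: "sigma_algebra {0..1::real} (sets (restrict_space borel {0..1}))"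
  using sets.sigma_algebra_axioms[of "restrict_space borel {0..1::real}"]
  by (simp add: space_restrict_space)

lemma sets_T_op [simp]: "sets (T_op f \<mu>) = sets (restrict_space borel {0..1})"
  unfolding T_op_def by (rule sigma_algebra.sets_measure_of_eq[OF sigma_algebra_unit])

theorem emeasure_T_op:
  assumes f: "f \<in> class_C" and mu: "\<mu> \<in> class_M" and P: "admissible f P"
    and A: "A \<in> sets (restrict_space borel {0..1})"
  shows "emeasure (T_op f \<mu>) A =
    (\<Sum>\<^sub>\<infinity>I \<in> basic_intervals P. emeasure \<mu> (pimage f (I \<inter> A)))"
proof -
  let ?S = "sets (restrict_space borel {0..1::real})"
  let ?F = "\<lambda>A. \<Sum>\<^sub>\<infinity>I \<in> basic_intervals P. emeasure \<mu> (pimage f (I \<inter> A))"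
  let ?G = "\<lambda>A. \<Sum>\<^sub>\<infinity>I \<in> basic_intervals (SOME P. admissible f P). emeasure \<mu> (pimage f (I \<inter> A))"
  have adm: "admissible f (SOME P. admissible f P)" using P by (rule someI)
  have FG: "?G B = ?F B" if "B \<in> ?S" for B
    using T_sum_eq_indicatrix[OF f mu adm that] T_sum_eq_indicatrix[OF f mu P that] by simp
  obtain g where g: "eq_C f g" "pw_monotone g P" using P by (auto simp: admissible_def)
  have s: "sets \<mu> = ?S" using mu by (simp add: class_M_def)
  have bor: "B \<in> sets borel" if "B \<in> ?S" for B using that by (auto simp: sets_restrict_space_iff)
  have Fg: "?F B = (\<integral>\<^sup>+I. emeasure \<mu> (pimage g (I \<inter> B)) \<partial>count_space (basic_intervals P))"
    if "B \<in> ?S" for B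
    unfolding infsum_ennreal_eq_nn_integral
    using pimage_eq_C[OF f mu g _ bor[OF that]] by (intro nn_integral_cong) auto
  have "positive ?S ?G" by (simp add: positive_def pimage_def)
  moreover have "countably_additive ?S ?G"
  proof (rule countably_additiveI)
    fix B :: "nat \<Rightarrow> real set"
    assume B: "range B \<subseteq> ?S" "disjoint_family B" "(\<Union>i. B i) \<in> ?S"
    have Bi: "B i \<in> ?S" for i using B(1) by auto
    have "(\<Sum>i. ?G (B i)) =
       (\<Sum>i. \<integral>\<^sup>+I. emeasure \<mu> (pimage g (I \<inter> B i)) \<partial>count_space (basic_intervals P))"
      using FG[OF Bi] Fg[OF Bi] by simp
    also have "\<dots> = (\<integral>\<^sup>+I. (\<Sum>i. emeasure \<mu> (pimage g (I \<inter> B i))) \<partial>count_space (basic_intervals P))"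
      by (rule nn_integral_suminf[symmetric]) auto
    also have "\<dots> = (\<integral>\<^sup>+I. emeasure \<mu> (pimage g (I \<inter> (\<Union>i. B i))) \<partial>count_space (basic_intervals P))"
    proof (rule nn_integral_cong)
      fix I assume "I \<in> space (count_space (basic_intervals P))"
      then have I: "I \<in> basic_intervals P" by simp
      have "(\<Sum>i. emeasure \<mu> (pimage g (I \<inter> B i))) = emeasure \<mu> (\<Union>i. pimage g (I \<inter> B i))"
      proof (rule suminf_emeasure)
        show "range (\<lambda>i. pimage g (I \<inter> B i)) \<subseteq> sets \<mu>"
          using pimage_borel[OF g(2) I bor[OF Bi]] s by auto
        show "disjoint_family (\<lambda>i. pimage g (I \<inter> B i))"
          unfolding disjoint_family_on_def
        proof (intro ballI impI equals0I)
          fix m n :: nat and y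
          assume "m \<noteq> n" "y \<in> pimage g (I \<inter> B m) \<inter> pimage g (I \<inter> B n)"
          then obtain a b where "a \<in> I" "a \<in> B m" "b \<in> I" "b \<in> B n" "g a = g b"
            by (auto simp: pimage_iff)
          then show False using pw_monotone_inj[OF g(2) I, of a b] B(2) \<open>m \<noteq> n\<close>
            by (auto simp: disjoint_family_on_def)
        qed
      qed
      also have "(\<Union>i. pimage g (I \<inter> B i)) = pimage g (I \<inter> (\<Union>i. B i))"
        by (subst set_eq_iff) (simp add: pimage_iff, blast)
      finally show "(\<Sum>i. emeasure \<mu> (pimage g (I \<inter> B i))) = emeasure \<mu> (pimage g (I \<inter> (\<Union>i. B i)))" .
    qed
    also have "\<dots> = ?G (\<Union>i. B i)" using FG[OF B(3)] Fg[OF B(3)] by simp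
    finally show "(\<Sum>i. ?G (B i)) = ?G (\<Union>i. B i)" .
  qed
  ultimately have "emeasure (T_op f \<mu>) A = ?G A"
    unfolding T_op_def using sigma_algebra_unit A by (intro emeasure_measure_of_sigma)
  then show ?thesis using FG[OF A] by simp
qed

end

theory Submission
  imports Defs
begin

text \<open>An interval \<open>J\<close> of finite \<open>\<mu>\<close>-measure meets at most \<open>\<mu> J / \<delta> + 2\<close> basic intervals, and \<open>f\<close>
  multiplies both measures by \<open>\<lambda>\<close> on each of them. Hence a bound \<open>\<nu> J \<le> a * \<mu> J + e\<close> valid for all
  such intervals implies \<open>\<nu> J \<le> (a + e / (\<lambda> * \<delta>)) * \<mu> J + (2 / \<lambda>) * e\<close>; as \<open>\<lambda> > 2\<close>, iterating
  removes the additive error and gives \<open>\<nu> J \<le> (a + e / (\<delta> * (\<lambda> - 2))) * \<mu> J\<close>. Starting from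
  \<open>\<nu> J \<le> 1\<close>, there is a least constant \<open>c\<close> with \<open>\<nu> \<le> c * \<mu>\<close> on intervals. The same estimate shows
  that \<open>c\<close> is nearly attained on intervals whose \<open>\<mu>\<close>-measure is bounded below. These cannot shrink
  to a point, because \<open>\<nu>\<close> is finite and nonatomic, so in the limit there is a nondegenerate
  interval on which \<open>\<nu> = c * \<mu>\<close>. This equality passes to images under \<open>f\<close>, so by substantial
  transitivity it holds on all of the unit interval, where \<open>\<nu>\<close> is finite and \<open>\<mu>\<close> is not.\<close>

section \<open>Basic intervals and the common setting of the two measures\<close>

lemma basic_intervals_is_interval: "I \<in> basic_intervals P \<Longrightarrow> is_interval (I :: real set)"
  using in_components_connected
  by (auto simp: basic_intervals_def is_interval_connected_1)

lemma basic_intervals_subset: "I \<in> basic_intervals P \<Longrightarrow> I \<subseteq> {0..1}"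
  using Union_basic_intervals[of P] by blast

lemma basic_intervals_overlap:
  "I \<in> basic_intervals P \<Longrightarrow> J \<in> basic_intervals P \<Longrightarrow> x \<in> I \<Longrightarrow> x \<in> J \<Longrightarrow> I = J"
  unfolding basic_intervals_def using components_nonoverlap[of I "{0..1} - P" J] by blast

lemma basic_intervals_disjnt:
  "\<F> \<subseteq> basic_intervals P \<Longrightarrow> pairwise (\<lambda>I J. disjnt (I \<inter> A) (J \<inter> A)) \<F>"
  unfolding pairwise_def disjnt_def using basic_intervals_overlap by blast

lemma is_interval_borel: "is_interval (I :: real set) \<Longrightarrow> I \<in> sets borel"
  using borel_measurable_indicator real_interval_borel_measurable by blast

lemma class_M_sets: "\<mu> \<in> class_M \<Longrightarrow> A \<in> sets \<mu> \<longleftrightarrow> A \<in> sets borel \<and> A \<subseteq> {0..1}"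
  by (auto simp: class_M_def sets_restrict_space_iff)

lemma class_M_space: "\<mu> \<in> class_M \<Longrightarrow> space \<mu> = {0..1}"
  using sets_eq_imp_space_eq[of \<mu> "restrict_space borel {0..1}"]
  by (simp add: class_M_def space_restrict_space)

text \<open>A member that meets \<open>J\<close> without lying in it leaves \<open>J\<close> on the
  left or on the right. If two members leave on the same side, each contains the nearer to
  \<open>J\<close> of their two outside points, because each also reaches into \<open>J\<close>.
  Disjointness then makes them equal, so every side admits at most one.\<close>

lemma card_straddling_le_2:
  fixes \<I> :: "real set set"
  assumes disj: "\<And>I I' x. I \<in> \<I> \<Longrightarrow> I' \<in> \<I> \<Longrightarrow> x \<in> I \<Longrightarrow> x \<in> I' \<Longrightarrow> I = I'"
    and int: "\<And>I. I \<in> \<I> \<Longrightarrow> is_interval I" and J: "is_interval J"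
  defines "S \<equiv> {I\<in>\<I>. I \<inter> J \<noteq> {} \<and> \<not> I \<subseteq> J}"
  shows "finite S" "card S \<le> 2"
proof -
  define L where "L = {I\<in>\<I>. I \<inter> J \<noteq> {} \<and> (\<exists>x\<in>I. \<forall>y\<in>J. x < y)}"
  define R where "R = {I\<in>\<I>. I \<inter> J \<noteq> {} \<and> (\<exists>x\<in>I. \<forall>y\<in>J. y < x)}"
  have L1: "I = I'" if II: "I \<in> L" "I' \<in> L" for I I'
  proof -
    obtain x y where x: "x \<in> I" "\<forall>y\<in>J. x < y" "y \<in> I" "y \<in> J" using II by (auto simp: L_def)
    obtain x' y' where x': "x' \<in> I'" "\<forall>y\<in>J. x' < y" "y' \<in> I'" "y' \<in> J" using II by (auto simp: L_def)
    have mem: "I \<in> \<I>" "I' \<in> \<I>" using II by (auto simp: L_def)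
    have "x < y" "x < y'" "x' < y" "x' < y'" using x x' by auto
    then have "max x x' \<in> I" "max x x' \<in> I'"
      by (auto intro: mem_is_interval_1_I[OF int[OF mem(1)] x(1,3)]
          mem_is_interval_1_I[OF int[OF mem(2)] x'(1,3)])
    then show ?thesis using disj mem by blast
  qed
  have R1: "I = I'" if II: "I \<in> R" "I' \<in> R" for I I'
  proof -
    obtain x y where x: "x \<in> I" "\<forall>y\<in>J. y < x" "y \<in> I" "y \<in> J" using II by (auto simp: R_def)
    obtain x' y' where x': "x' \<in> I'" "\<forall>y\<in>J. y < x'" "y' \<in> I'" "y' \<in> J" using II by (auto simp: R_def)
    have mem: "I \<in> \<I>" "I' \<in> \<I>" using II by (auto simp: R_def)
    have "y < x" "y' < x" "y < x'" "y' < x'" using x x' by auto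
    then have "min x x' \<in> I" "min x x' \<in> I'"
      by (auto intro: mem_is_interval_1_I[OF int[OF mem(1)] x(3,1)]
          mem_is_interval_1_I[OF int[OF mem(2)] x'(3,1)])
    then show ?thesis using disj mem by blast
  qed
  have sub: "S \<subseteq> L \<union> R"
  proof
    fix I assume I: "I \<in> S"
    then obtain x where x: "x \<in> I" "x \<notin> J" by (auto simp: S_def)
    have "(\<forall>y\<in>J. x < y) \<or> (\<forall>y\<in>J. y < x)"
      by (metis x(2) mem_is_interval_1_I[OF J] linorder_not_less)
    then show "I \<in> L \<union> R" using I x by (auto simp: S_def L_def R_def)
  qed
  have "L = {} \<or> (\<exists>I. L = {I})" using L1 by blast
  then have "finite L" "card L \<le> 1" by auto
  have "R = {} \<or> (\<exists>I. R = {I})" using R1 by blast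
  then have "finite R" "card R \<le> 1" by auto
  with \<open>finite L\<close> \<open>card L \<le> 1\<close> have "finite (L \<union> R)" "card (L \<union> R) \<le> 2"
    using card_Un_le[of L R] by auto
  then show "finite S" "card S \<le> 2"
    using finite_subset[OF sub] card_mono[OF _ sub] by linarith+
qed

text \<open>\<open>g\<close> is the representative that is defined exactly off \<open>P\<close>; the
  basic intervals are its laps. The eigenvalue equations for the operator enter only lap by lap,
  through \<open>scale_mu\<close> and \<open>scale_nu\<close>, which \<open>conformal_on_lap\<close>
  derives. Transitivity and the infinite mass of \<mu> come in with
  \<open>not_substantially_transitive\<close>.\<close>

locale lap_expanding =
  fixes g :: "real \<rightharpoonup> real" and P :: "real set" and \<mu> \<nu> :: "real measure" and lam \<delta> :: real
  assumes pw: "pw_monotone g P"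
    and mu: "\<mu> \<in> class_M" and nu: "\<nu> \<in> class_M" and prob: "prob_space \<nu>"
    and lam: "lam > 2" and delta: "\<delta> > 0"
    and scale_mu: "\<And>I A. I \<in> basic_intervals P \<Longrightarrow> A \<in> sets borel \<Longrightarrow> A \<subseteq> I \<Longrightarrow>
      emeasure \<mu> (pimage g A) = ennreal lam * emeasure \<mu> A"
    and scale_nu: "\<And>I A. I \<in> basic_intervals P \<Longrightarrow> A \<in> sets borel \<Longrightarrow> A \<subseteq> I \<Longrightarrow>
      emeasure \<nu> (pimage g A) = ennreal lam * emeasure \<nu> A"
    and lap_lower: "\<And>I. I \<in> basic_intervals P \<Longrightarrow> ennreal \<delta> \<le> emeasure \<mu> I"
    and lap_finite: "\<And>I. I \<in> basic_intervals P \<Longrightarrow> emeasure \<mu> I < \<infinity>"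
begin

section \<open>Intervals of finite measure and the laps that they meet\<close>

sublocale nu: prob_space \<nu> by (rule prob)

text \<open>Open, closed and half-open intervals are all allowed, since basic intervals and their
  images need not be closed.\<close>

definition fin_int :: "real set \<Rightarrow> bool" where
  "fin_int J \<longleftrightarrow> is_interval J \<and> J \<subseteq> {0..1} \<and> emeasure \<mu> J < \<infinity>"

lemma cc: "closed_countable P"
  using pw by (simp add: pw_monotone_def)

lemma fin_int_borel: "fin_int J \<Longrightarrow> J \<in> sets borel"
  by (simp add: fin_int_def is_interval_borel)

lemma fin_int_sets:
  assumes "fin_int J" shows "J \<in> sets \<mu>" "J \<in> sets \<nu>" "J \<in> fmeasurable \<mu>" "J \<in> fmeasurable \<nu>"
proof -
  show *: "J \<in> sets \<mu>" "J \<in> sets \<nu>"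
    using assms fin_int_borel class_M_sets[OF mu] class_M_sets[OF nu] by (auto simp: fin_int_def)
  then show "J \<in> fmeasurable \<mu>" "J \<in> fmeasurable \<nu>"
    using assms by (auto simp: fin_int_def fmeasurable_def nu.emeasure_finite less_top[symmetric])
qed

lemma fin_int_subset: "fin_int J \<Longrightarrow> is_interval K \<Longrightarrow> K \<subseteq> J \<Longrightarrow> fin_int K"
  using emeasure_mono[of K J \<mu>] fin_int_sets(1)[of J] by (fastforce simp: fin_int_def)

lemma lap_fin_int: "I \<in> basic_intervals P \<Longrightarrow> fin_int I"
  using lap_finite by (simp add: fin_int_def basic_intervals_is_interval basic_intervals_subset)

text \<open>This makes the class of intervals stable under the branches of \<open>g\<close>, so that
  a bound assumed for all its members may be applied again to images. Continuity on a lap keeps the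
  image connected, and the finite factor \<open>lam\<close> keeps its \<mu>-measure finite.\<close>

lemma fin_int_pimage:
  assumes J: "fin_int J" and I: "I \<in> basic_intervals P"
  shows "fin_int (pimage g (I \<inter> J))"
    and "measure \<mu> (pimage g (I \<inter> J)) = lam * measure \<mu> (I \<inter> J)"
    and "measure \<nu> (pimage g (I \<inter> J)) = lam * measure \<nu> (I \<inter> J)"
proof -
  have IJ: "is_interval (I \<inter> J)" "fin_int (I \<inter> J)"
    using J basic_intervals_is_interval[OF I] fin_int_subset[OF J, of "I \<inter> J"]
    by (auto simp: fin_int_def is_interval_Int)
  have eq: "pimage g (I \<inter> J) = (\<lambda>x. the (g x)) ` (I \<inter> J)"
    using pw_monotone_defined[OF pw I] by (force simp: pimage_iff)
  have "continuous_on (I \<inter> J) (\<lambda>x. the (g x))"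
    using pw I by (auto simp: pw_monotone_def intro: continuous_on_subset)
  then have "is_interval (pimage g (I \<inter> J))"
    unfolding eq using IJ by (simp add: is_interval_connected_1 connected_continuous_image)
  moreover have "pimage g (I \<inter> J) \<subseteq> {0..1}"
    using pw by (force simp: pimage_iff pw_monotone_def ran_def)
  moreover have mI: "emeasure \<mu> (pimage g (I \<inter> J)) = ennreal lam * emeasure \<mu> (I \<inter> J)"
    using IJ by (intro scale_mu[OF I]) (auto simp: fin_int_borel)
  ultimately show "fin_int (pimage g (I \<inter> J))"
    using IJ(2) by (auto simp: fin_int_def ennreal_mult_less_top)
  show "measure \<mu> (pimage g (I \<inter> J)) = lam * measure \<mu> (I \<inter> J)"
    using mI lam by (simp add: measure_def enn2real_mult)
  have "emeasure \<nu> (pimage g (I \<inter> J)) = ennreal lam * emeasure \<nu> (I \<inter> J)"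
    using IJ by (intro scale_nu[OF I]) (auto simp: fin_int_borel)
  then show "measure \<nu> (pimage g (I \<inter> J)) = lam * measure \<nu> (I \<inter> J)"
    using lam by (simp add: measure_def enn2real_mult)
qed

abbreviation laps :: "real set \<Rightarrow> real set set" where
  "laps J \<equiv> {I \<in> basic_intervals P. I \<inter> J \<noteq> {}}"

text \<open>Laps inside \<open>J\<close> are disjoint and each has \<mu>-measure at least \<delta>,
  which bounds their number by the quotient. The summand 2 pays for the laps that stick out of
  \<open>J\<close>.\<close>

lemma laps_bound:
  assumes J: "fin_int J"
  shows "finite (laps J)" and "real (card (laps J)) \<le> measure \<mu> J / \<delta> + 2"
proof -
  let ?A = "{I \<in> basic_intervals P. I \<subseteq> J}"
  let ?S = "{I \<in> basic_intervals P. I \<inter> J \<noteq> {} \<and> \<not> I \<subseteq> J}"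
  have S: "finite ?S" "card ?S \<le> 2"
    using card_straddling_le_2[of "basic_intervals P" J] J
    by (auto simp: fin_int_def basic_intervals_is_interval dest: basic_intervals_overlap)
  \<comment> \<open>Finiteness of the family of laps inside \<open>J\<close> is not yet known, so
    finite subfamilies are counted first; their uniform bound then yields finiteness.\<close>
  have bound: "real (card F) \<le> measure \<mu> J / \<delta>" if F: "finite F" "F \<subseteq> ?A" for F
  proof -
    have "\<delta> \<le> measure \<mu> I" if "I \<in> F" for I
    proof -
      have "I \<in> basic_intervals P" using that F by auto
      then show ?thesis
        using lap_lower[of I] lap_finite[of I] delta enn2real_mono[of "ennreal \<delta>" "emeasure \<mu> I"]
        by (simp add: measure_def)
    qed
    then have "real (card F) * \<delta> \<le> (\<Sum>I\<in>F. measure \<mu> I)"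
      using sum_bounded_below[of F \<delta> "measure \<mu>"] by simp
    also have "\<dots> = measure \<mu> (\<Union>I\<in>F. I)"
      using F lap_fin_int fin_int_sets(3) basic_intervals_disjnt[of F P UNIV]
      by (intro measure_UNION'[symmetric]) auto
    also have "\<dots> \<le> measure \<mu> J"
      using F lap_fin_int fin_int_sets(1,3) J
      by (intro measure_mono_fmeasurable sets.finite_UN) auto
    finally show ?thesis using delta by (simp add: field_simps)
  qed
  have "finite ?A \<and> card ?A \<le> nat \<lfloor>measure \<mu> J / \<delta>\<rfloor>"
    using bound by (intro finite_if_finite_subsets_card_bdd) (auto simp: le_nat_floor)
  then have A: "finite ?A" by blast
  have sub: "laps J \<subseteq> ?A \<union> ?S" by auto
  then show "finite (laps J)" using A S finite_subset by blast
  have "card (laps J) \<le> card ?A + card ?S"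
    using card_mono[OF _ sub] card_Un_le[of ?A ?S] A S by auto
  then show "real (card (laps J)) \<le> measure \<mu> J / \<delta> + 2"
    using bound[OF A order_refl] S by linarith
qed

lemma measure_split_laps:
  assumes J: "fin_int J" and M: "M \<in> class_M" "J \<in> fmeasurable M"
  shows "measure M J = (\<Sum>I\<in>laps J. measure M (I \<inter> J))"
proof -
  have IJ: "I \<inter> J \<in> fmeasurable M" if "I \<in> basic_intervals P" for I
    using that M fin_int_borel[OF lap_fin_int] basic_intervals_subset class_M_sets[OF M(1)] 
    by (intro fmeasurable_Int_fmeasurable[of J, unfolded Int_commute[of J]]) auto
  \<comment> \<open>Nonatomicity makes the countable set \<open>P\<close> null, so the laps carry
    all of the measure.\<close>
  have Z: "J \<inter> P \<in> null_sets M"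
    using cc by (intro class_M_countable[OF M(1)]) (auto simp: closed_countable_def)
  have "J - J \<inter> P = (\<Union>I\<in>laps J. I \<inter> J)"
    using Union_basic_intervals[of P] J unfolding fin_int_def by blast
  then have "measure M J = measure M (\<Union>I\<in>laps J. I \<inter> J)"
    using measure_Diff_null_set[OF _ Z, of J] M by auto
  also have "\<dots> = (\<Sum>I\<in>laps J. measure M (I \<inter> J))"
    using laps_bound(1)[OF J] IJ basic_intervals_disjnt[of "laps J" P J]
    by (intro measure_UNION') auto
  finally show ?thesis .
qed

section \<open>Absorbing additive errors\<close>

lemma bound_step:
  assumes H: "\<And>J. fin_int J \<Longrightarrow> measure \<nu> J \<le> a * measure \<mu> J + e" and e: "e \<ge> 0"
    and J: "fin_int J"
  shows "measure \<nu> J \<le> (a + e / (lam * \<delta>)) * measure \<mu> J + 2 * e / lam"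
proof -
  \<comment> \<open>Each lap is expanded by \<open>g\<close> and \<open>H\<close> is applied to the
    image. The main terms add up to the measure of \<open>J\<close> times \<open>lam\<close>, while
    every lap contributes one error \<open>e\<close>.\<close>
  have "lam * measure \<nu> J = (\<Sum>I\<in>laps J. measure \<nu> (pimage g (I \<inter> J)))"
    using fin_int_pimage(3)[OF J] measure_split_laps[OF J nu fin_int_sets(4)[OF J]]
    by (simp add: sum_distrib_left)
  also have "\<dots> \<le> (\<Sum>I\<in>laps J. a * measure \<mu> (pimage g (I \<inter> J)) + e)"
    using fin_int_pimage(1)[OF J] H by (intro sum_mono) auto
  also have "\<dots> = a * (lam * measure \<mu> J) + e * card (laps J)"
    using fin_int_pimage(2)[OF J] measure_split_laps[OF J mu fin_int_sets(3)[OF J]]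
    by (simp add: sum.distrib sum_distrib_left)
  also have "\<dots> \<le> a * (lam * measure \<mu> J) + e * (measure \<mu> J / \<delta> + 2)"
    using laps_bound(2)[OF J] e by (intro add_left_mono mult_left_mono)
  finally show ?thesis using lam delta by (simp add: field_simps)
qed

text \<open>After \<open>n\<close> rounds of \<open>bound_step\<close> the additive error is
  \<open>e * (2/lam)^n\<close>, which tends to 0. The increments of the slope form a geometric
  series with first term \<open>e / (lam * \<delta>)\<close> and ratio \<open>2/lam\<close>, whose
  sum is \<open>e / (\<delta> * (lam - 2))\<close>.\<close>

lemma bound_improve:
  assumes H: "\<And>J. fin_int J \<Longrightarrow> measure \<nu> J \<le> a * measure \<mu> J + e" and e: "e \<ge> 0"
    and J: "fin_int J"
  shows "measure \<nu> J \<le> (a + e / (\<delta> * (lam - 2))) * measure \<mu> J"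
proof -
  define C where "C = e / (\<delta> * (lam - 2))"
  have C: "C \<ge> 0" "C * (lam - 2) * \<delta> = e" using e lam delta by (auto simp: C_def)
  have *: "measure \<nu> K \<le> (a + C * (1 - (2/lam)^n)) * measure \<mu> K + e * (2/lam)^n"
    if "fin_int K" for n K
    using that
  proof (induction n arbitrary: K)
    case 0
    then show ?case using H by simp
  next
    case (Suc n)
    define q where "q = (2/lam)^n"
    have "0 \<le> e * q" using e lam by (simp add: q_def)
    from bound_step[OF Suc.IH[folded q_def] this Suc.prems]
    have "measure \<nu> K \<le> (a + C * (1 - q) + e * q / (lam * \<delta>)) * measure \<mu> K + 2 * (e * q) / lam" .
    \<comment> \<open>Writing \<open>e\<close> as \<open>C * (lam - 2) * \<delta>\<close> turns the
      new increment into \<open>C * q * (1 - 2 / lam)\<close>, so the partial sums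
      telescope.\<close>
    also have "a + C * (1 - q) + e * q / (lam * \<delta>) = a + C * (1 - 2 / lam * q)"
      using lam delta unfolding C(2)[symmetric] by (simp add: field_simps)
    finally show ?case by (simp add: q_def mult_ac)
  qed
  have "(\<lambda>n. (2/lam)^n) \<longlonglongrightarrow> 0" using lam by (intro LIMSEQ_power_zero) (simp add: field_simps)
  then have "(\<lambda>n. (a + C * (1 - (2/lam)^n)) * measure \<mu> J + e * (2/lam)^n)
      \<longlonglongrightarrow> (a + C * (1 - 0)) * measure \<mu> J + e * 0"
    by (intro tendsto_add tendsto_mult tendsto_diff tendsto_const)
  then have "measure \<nu> J \<le> (a + C * (1 - 0)) * measure \<mu> J + e * 0"
    using *[OF J] by (intro LIMSEQ_le_const) auto
  then show ?thesis by (simp add: C_def)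
qed

section \<open>The best constant and an interval on which it is attained\<close>

definition best :: real where
  "best = Inf {c. c \<ge> 0 \<and> (\<forall>J. fin_int J \<longrightarrow> measure \<nu> J \<le> c * measure \<mu> J)}"

lemma best_nonneg: "best \<ge> 0"
  and best_bound: "fin_int J \<Longrightarrow> measure \<nu> J \<le> best * measure \<mu> J"
  and best_least: "c \<ge> 0 \<Longrightarrow> (\<And>J. fin_int J \<Longrightarrow> measure \<nu> J \<le> c * measure \<mu> J) \<Longrightarrow> best \<le> c"
proof -
  let ?S = "{c. c \<ge> 0 \<and> (\<forall>J. fin_int J \<longrightarrow> measure \<nu> J \<le> c * measure \<mu> J)}"
  \<comment> \<open>Since \<nu> has total mass 1, \<open>bound_improve\<close> may start from slope
    0 and error 1. This gives a member of the set, so that its infimum is meaningful.\<close>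
  have "0 + 1 / (\<delta> * (lam - 2)) \<in> ?S"
    using bound_improve[of 0 1] lam delta by auto
  then have ne: "?S \<noteq> {}" by blast
  show "best \<ge> 0" unfolding best_def by (rule cInf_greatest[OF ne]) auto
  have bdd: "bdd_below ?S" by (rule bdd_belowI[of _ 0]) auto
  show "best \<le> c" if "c \<ge> 0" "\<And>J. fin_int J \<Longrightarrow> measure \<nu> J \<le> c * measure \<mu> J" for c
    unfolding best_def using that by (intro cInf_lower[OF _ bdd]) auto
  show "measure \<nu> J \<le> best * measure \<mu> J" if J: "fin_int J"
  proof (cases "measure \<mu> J = 0")
    case True
    \<comment> \<open>No quotient of measures is available here, but any constant in the set already
      forces \<open>measure \<nu> J\<close> to vanish.\<close>
    then show ?thesis using ne J by force
  next
    case False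
    then have p: "measure \<mu> J > 0" by (simp add: zero_less_measure_iff)
    have "measure \<nu> J / measure \<mu> J \<le> best"
      unfolding best_def using J p by (intro cInf_greatest[OF ne]) (auto simp: field_simps)
    then show ?thesis using p by (simp add: field_simps)
  qed
qed

text \<open>With constant 0 all laps would be \<nu>-null. Being countably many, they would together
  with the null set \<open>P\<close> exhaust a space of measure 1.\<close>

lemma best_pos: "best > 0"
proof (rule ccontr)
  assume "\<not> best > 0"
  then have "best = 0" using best_nonneg by simp
  then have z: "I \<in> null_sets \<nu>" if "I \<in> basic_intervals P" for I
    using best_bound[OF lap_fin_int[OF that]] fin_int_sets(2)[OF lap_fin_int[OF that]]
    by (simp add: nu.emeasure_eq_measure null_setsI measure_le_0_iff)
  have "(\<Union>I\<in>basic_intervals P. I) \<in> null_sets \<nu>"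
    using z countable_basic_intervals[OF cc] by (intro null_sets_UN') auto
  moreover have "P \<in> null_sets \<nu>"
    using cc by (intro class_M_countable[OF nu]) (auto simp: closed_countable_def)
  ultimately have "(\<Union>I\<in>basic_intervals P. I) \<union> P \<in> null_sets \<nu>" by blast
  moreover have "(\<Union>I\<in>basic_intervals P. I) \<union> P = space \<nu>"
    using Union_basic_intervals[of P] cc class_M_space[OF nu] by (auto simp: closed_countable_def)
  ultimately show False using nu.emeasure_space_1 by auto
qed

text \<open>If all long intervals violated this, then
  \<open>\<nu> J \<le> (best - \<epsilon>) * \<mu> J + \<epsilon> * \<eta>\<close> with \<open>\<eta> = \<delta> * (lam - 2) / 2\<close> would hold for all
  intervals, and absorbing the additive error would give the constant \<open>best - \<epsilon> / 2\<close>.\<close>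

lemma long_near_optimal:
  assumes "\<epsilon> > 0" "\<epsilon> < best"
  shows "\<exists>L. fin_int L \<and> measure \<mu> L \<ge> \<delta> * (lam - 2) / 2 \<and>
    measure \<nu> L > (best - \<epsilon>) * measure \<mu> L"
proof (rule ccontr)
  define \<eta> where "\<eta> = \<delta> * (lam - 2) / 2"
  assume "\<not> ?thesis"
  then have N: "\<And>L. fin_int L \<Longrightarrow> measure \<mu> L \<ge> \<eta> \<Longrightarrow> measure \<nu> L \<le> (best - \<epsilon>) * measure \<mu> L"
    unfolding \<eta>_def by force
  have eta: "\<eta> > 0" using delta lam by (simp add: \<eta>_def)
  have "measure \<nu> J \<le> (best - \<epsilon>) * measure \<mu> J + \<epsilon> * \<eta>" if J: "fin_int J" for J
  proof (cases "measure \<mu> J \<ge> \<eta>")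
    case True
    have "0 \<le> \<epsilon> * \<eta>" using assms eta by simp
    then show ?thesis using N[OF J True] by linarith
  next
    case False
    then have "\<epsilon> * measure \<mu> J \<le> \<epsilon> * \<eta>" using assms by (intro mult_left_mono) auto
    then show ?thesis using best_bound[OF J] by (simp add: algebra_simps)
  qed
  moreover have "0 \<le> \<epsilon> * \<eta>" using assms eta by simp
  moreover have "\<epsilon> * \<eta> / (\<delta> * (lam - 2)) = \<epsilon> / 2"
    using delta lam by (simp add: \<eta>_def field_simps)
  then have "best - \<epsilon> + \<epsilon> * \<eta> / (\<delta> * (lam - 2)) = best - \<epsilon> / 2" by linarith
  ultimately have "measure \<nu> J \<le> (best - \<epsilon> / 2) * measure \<mu> J" if "fin_int J" for J
    using bound_improve[of "best - \<epsilon>" "\<epsilon> * \<eta>" J] that by metis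
  then have "best \<le> best - \<epsilon> / 2" using assms by (intro best_least) auto
  then show False using assms by simp
qed

text \<open>The defect \<open>best * \<mu> - \<nu>\<close> is additive and, by
  \<open>best_bound\<close>, nonnegative on intervals. Cutting off the parts of \<open>L\<close> to
  the left and right of \<open>{p..q}\<close> can therefore only decrease it.\<close>

lemma defect_mono:
  assumes L: "fin_int L" and "p \<le> q" and K: "{p..q} \<subseteq> L"
  shows "fin_int {p..q}"
    and "best * measure \<mu> {p..q} - measure \<nu> {p..q} \<le> best * measure \<mu> L - measure \<nu> L"
proof -
  have iL: "is_interval L" using L by (simp add: fin_int_def)
  have A1: "fin_int (L \<inter> {..<p})"
    by (rule fin_int_subset[OF L is_interval_Int[OF iL is_interval_io] Int_lower1])
  have A2: "fin_int {p..q}"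
    by (rule fin_int_subset[OF L is_interval_cc K])
  have A3: "fin_int (L \<inter> {q<..})"
    by (rule fin_int_subset[OF L is_interval_Int[OF iL is_interval_oi] Int_lower1])
  show "fin_int {p..q}" by (rule A2)
  have eq: "L = (L \<inter> {..<p} \<union> {p..q}) \<union> (L \<inter> {q<..})"
    using K by (intro equalityI subsetI) auto
  have sp: "measure M L = measure M (L \<inter> {..<p}) + measure M {p..q} + measure M (L \<inter> {q<..})"
    if "M = \<mu> \<or> M = \<nu>" for M
  proof -
    have f: "L \<inter> {..<p} \<in> fmeasurable M" "{p..q} \<in> fmeasurable M" "L \<inter> {q<..} \<in> fmeasurable M"
      using that fin_int_sets(3,4)[OF A1] fin_int_sets(3,4)[OF A2] fin_int_sets(3,4)[OF A3] by auto
    have U: "L \<inter> {..<p} \<union> {p..q} \<in> fmeasurable M" using f by (intro fmeasurable.Un)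
    have "(L \<inter> {..<p} \<union> {p..q}) \<inter> (L \<inter> {q<..}) = {}" using \<open>p \<le> q\<close> by auto
    then have "measure M ((L \<inter> {..<p} \<union> {p..q}) \<union> (L \<inter> {q<..})) =
        measure M (L \<inter> {..<p} \<union> {p..q}) + measure M (L \<inter> {q<..})"
      using U f(3) by (intro measure_Union) (auto dest: fmeasurableD2)
    then have "measure M L = measure M (L \<inter> {..<p} \<union> {p..q}) + measure M (L \<inter> {q<..})"
      by (simp only: eq[symmetric])
    moreover have "measure M (L \<inter> {..<p} \<union> {p..q}) = measure M (L \<inter> {..<p}) + measure M {p..q}"
      using f by (intro measure_Union) (auto dest: fmeasurableD2)
    ultimately show ?thesis by simp
  qed
  have "measure \<nu> (L \<inter> {..<p}) \<le> best * measure \<mu> (L \<inter> {..<p})"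
    "measure \<nu> (L \<inter> {q<..}) \<le> best * measure \<mu> (L \<inter> {q<..})"
    by (rule best_bound[OF A1] best_bound[OF A3])+
  then show "best * measure \<mu> {p..q} - measure \<nu> {p..q} \<le> best * measure \<mu> L - measure \<nu> L"
    using sp[of \<mu>] sp[of \<nu>] by (simp add: algebra_simps)
qed

text \<open>Take long intervals whose defects tend to 0 and pass to a subsequence whose endpoints
  converge. A compact interval strictly between the limits lies in all late members, so by
  \<open>defect_mono\<close> its own defect is 0.\<close>

lemma optimal_interval:
  "\<exists>a b. 0 \<le> a \<and> a < b \<and> b \<le> 1 \<and> (\<forall>p q. a < p \<longrightarrow> p \<le> q \<longrightarrow> q < b \<longrightarrow>
     fin_int {p..q} \<and> measure \<nu> {p..q} = best * measure \<mu> {p..q})"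
proof -
  \<comment> \<open>The bound by \<open>best / 2\<close> keeps \<nu> above
    \<open>best / 2 * \<mu>\<close> on \<open>L k\<close>, hence the \<mu>-measures of the
    \<open>L k\<close> at most \<open>2 / best\<close>. The factor \<open>1 / Suc k\<close> then
    drives the defects to 0.\<close>
  define \<epsilon> where "\<epsilon> k = best / (2 * real (Suc k))" for k
  define \<eta> where "\<eta> = \<delta> * (lam - 2) / 2"
  have eta: "\<eta> > 0" using delta lam by (simp add: \<eta>_def)
  have eps: "\<epsilon> k > 0" "\<epsilon> k \<le> best / 2" for k
    using best_pos by (auto simp: \<epsilon>_def field_simps)
  then have eps': "\<epsilon> k < best" for k
    using best_pos eps(2)[of k] by linarith
  have "\<forall>k. \<exists>L. fin_int L \<and> measure \<mu> L \<ge> \<eta> \<and> measure \<nu> L > (best - \<epsilon> k) * measure \<mu> L"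
    using long_near_optimal[OF eps(1) eps'] unfolding \<eta>_def by blast
  then obtain L where L: "\<And>k. fin_int (L k)" "\<And>k. measure \<mu> (L k) \<ge> \<eta>"
    "\<And>k. measure \<nu> (L k) > (best - \<epsilon> k) * measure \<mu> (L k)" by metis
  have Lsub: "L k \<subseteq> {0..1}" and Lint: "is_interval (L k)" for k
    using L(1) by (auto simp: fin_int_def)
  have Lhalf: "measure \<nu> (L k) > best / 2 * measure \<mu> (L k)" for k
  proof -
    have "best / 2 * measure \<mu> (L k) \<le> (best - \<epsilon> k) * measure \<mu> (L k)"
      using eps(2)[of k] by (intro mult_right_mono) auto
    then show ?thesis using L(3)[of k] by linarith
  qed
  have Lbig: "measure \<nu> (L k) > best / 2 * \<eta>" for k
  proof -
    have "best / 2 * \<eta> \<le> best / 2 * measure \<mu> (L k)"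
      using L(2)[of k] best_pos by (intro mult_left_mono) auto
    then show ?thesis using Lhalf[of k] by linarith
  qed
  have defect: "best * measure \<mu> (L k) - measure \<nu> (L k) \<le> inverse (real (Suc k))" for k
  proof -
    have "best / 2 * measure \<mu> (L k) \<le> 1"
      using Lhalf[of k] nu.prob_le_1[of "L k"] by linarith
    then have "best / 2 * measure \<mu> (L k) / real (Suc k) \<le> 1 / real (Suc k)"
      by (intro divide_right_mono) auto
    moreover have "\<epsilon> k * measure \<mu> (L k) = best / 2 * measure \<mu> (L k) / real (Suc k)"
      by (simp add: \<epsilon>_def)
    ultimately have "\<epsilon> k * measure \<mu> (L k) \<le> inverse (real (Suc k))"
      by (simp add: inverse_eq_divide)
    then show ?thesis using L(3)[of k] by (simp add: algebra_simps)
  qed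
  \<comment> \<open>\<open>L k\<close> may or may not contain its endpoints; it lies between the
    open and the closed interval that they span.\<close>
  define a where "a k = Inf (L k)" for k
  define b where "b k = Sup (L k)" for k
  have ne: "L k \<noteq> {}" for k using L(2)[of k] eta by (metis measure_empty not_less)
  have bd: "bdd_below (L k)" "bdd_above (L k)" for k
    using Lsub[of k] by (auto intro: bdd_below_mono[of "{0..1}"] bdd_above_mono[of "{0..1}"])
  have out: "L k \<subseteq> {a k..b k}" for k
    using bd[of k] by (auto simp: a_def b_def intro: cInf_lower cSup_upper)
  have inn: "x \<in> L k" if x: "a k < x" "x < b k" for k x
  proof -
    obtain u where u: "u \<in> L k" "u < x"
      using x(1)[unfolded a_def] cInf_less_iff[OF ne[of k] bd(1)[of k], of x] by auto
    obtain v where v: "v \<in> L k" "x < v"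
      using x(2)[unfolded b_def] less_cSup_iff[OF ne[of k] bd(2)[of k], of x] by auto
    show ?thesis using mem_is_interval_1_I[OF Lint u(1) v(1)] u v by auto
  qed
  have ab: "a k \<le> b k" for k using ne[of k] out[of k] by fastforce
  have "0 \<le> a k" "b k \<le> 1" for k
    unfolding a_def b_def using Lsub[of k] by (auto intro!: cInf_greatest[OF ne] cSup_least[OF ne])
  then have mem: "(a k, b k) \<in> {0..1} \<times> {0..1}" for k using ab[of k] by (auto intro: order_trans)
  have "seq_compact ({0..1::real} \<times> {0..1::real})"
    by (intro compact_imp_seq_compact compact_Times compact_Icc)
  from seq_compactE[OF this, of "\<lambda>k. (a k, b k)"]
  obtain l r where lr: "l \<in> {0..1} \<times> {0..1}" "strict_mono (r :: nat \<Rightarrow> nat)"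
    "((\<lambda>k. (a k, b k)) \<circ> r) \<longlonglongrightarrow> l"
    using mem by blast
  define \<alpha> \<beta> where "\<alpha> = fst l" and "\<beta> = snd l"
  have lim: "(\<lambda>k. a (r k)) \<longlonglongrightarrow> \<alpha>" "(\<lambda>k. b (r k)) \<longlonglongrightarrow> \<beta>"
    using tendsto_fst[OF lr(3)] tendsto_snd[OF lr(3)] by (simp_all add: \<alpha>_def \<beta>_def o_def)
  have range: "\<alpha> \<in> {0..1}" "\<beta> \<in> {0..1}" using lr(1) by (auto simp: \<alpha>_def \<beta>_def)
  have "\<alpha> \<le> \<beta>" using lim ab by (intro LIMSEQ_le[OF lim]) auto
  moreover have "\<alpha> \<noteq> \<beta>"
  proof
    assume eq: "\<alpha> = \<beta>"
    \<comment> \<open>If the endpoints had a common limit, late members of the subsequence would lie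
      in any given \<open>A n\<close>. But the \<nu>-measure of \<open>A n\<close> tends to that of
      at most one point, which is 0, against the lower bound \<open>Lbig\<close>.\<close>
    define A where "A n = {\<alpha> - inverse (real (Suc n))..\<alpha> + inverse (real (Suc n))} \<inter> {0..1}" for n
    have limA: "(\<lambda>n. measure \<nu> (A n)) \<longlonglongrightarrow> measure \<nu> (\<Inter>n. A n)"
    proof (rule nu.finite_Lim_measure_decseq)
      show "range A \<subseteq> sets \<nu>" using class_M_sets[OF nu] by (auto simp: A_def)
      show "decseq A"
        unfolding A_def decseq_def
      proof (intro allI impI subsetI)
        fix m n :: nat and x assume "m \<le> n"
          and x: "x \<in> {\<alpha> - inverse (real (Suc n))..\<alpha> + inverse (real (Suc n))} \<inter> {0..1}"
        then have "inverse (real (Suc n)) \<le> inverse (real (Suc m))" by (intro le_imp_inverse_le) auto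
        then show "x \<in> {\<alpha> - inverse (real (Suc m))..\<alpha> + inverse (real (Suc m))} \<inter> {0..1}"
          using x unfolding Int_iff atLeastAtMost_iff by linarith
      qed
    qed
    have sub: "(\<Inter>n. A n) \<subseteq> {\<alpha>}"
    proof
      fix x assume "x \<in> (\<Inter>n. A n)"
      then have xA: "x \<in> A n" for n by blast
      have "\<bar>x - \<alpha>\<bar> \<le> inverse (real (Suc n))" for n
        using xA[of n] unfolding A_def Int_iff atLeastAtMost_iff by linarith
      then have "\<bar>x - \<alpha>\<bar> \<le> 0" by (intro LIMSEQ_le_const[OF LIMSEQ_inverse_real_of_nat]) auto
      then show "x \<in> {\<alpha>}" by simp
    qed
    have "(\<Inter>n. A n) \<in> null_sets \<nu>"
    proof (rule class_M_countable[OF nu])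
      show "countable (\<Inter>n. A n)" by (rule countable_subset[OF sub]) simp
      show "(\<Inter>n. A n) \<subseteq> {0..1}" using sub range by blast
    qed
    then have lim0: "(\<lambda>n. measure \<nu> (A n)) \<longlonglongrightarrow> 0"
      using limA by (simp add: measure_eq_0_null_sets)
    have "0 < best / 2 * \<eta>" using best_pos eta by simp
    from order_tendstoD(2)[OF lim0 this] obtain n where n: "measure \<nu> (A n) < best / 2 * \<eta>"
      using eventually_happens'[OF sequentially_bot] by blast
    let ?s = "inverse (real (Suc n))"
    have "\<forall>\<^sub>F k in sequentially. \<alpha> - ?s < a (r k)" "\<forall>\<^sub>F k in sequentially. b (r k) < \<alpha> + ?s"
      by (rule order_tendstoD(1)[OF lim(1)], simp) (rule order_tendstoD(2)[OF lim(2)[folded eq]], simp)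
    then have "\<forall>\<^sub>F k in sequentially. \<alpha> - ?s < a (r k) \<and> b (r k) < \<alpha> + ?s" by (rule eventually_conj)
    then obtain k where k: "\<alpha> - ?s < a (r k)" "b (r k) < \<alpha> + ?s"
      using eventually_happens'[OF sequentially_bot] by blast
    then have "L (r k) \<subseteq> A n" using out[of "r k"] Lsub[of "r k"] by (fastforce simp: A_def)
    then have "measure \<nu> (L (r k)) \<le> measure \<nu> (A n)"
      using class_M_sets[OF nu] by (intro nu.finite_measure_mono) (auto simp: A_def)
    then show False using Lbig[of "r k"] n by linarith
  qed
  ultimately have "\<alpha> < \<beta>" by simp
  moreover have "fin_int {p..q} \<and> measure \<nu> {p..q} = best * measure \<mu> {p..q}"
    if pq: "\<alpha> < p" "p \<le> q" "q < \<beta>" for p q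
  proof -
    have "\<forall>\<^sub>F k in sequentially. a (r k) < p" "\<forall>\<^sub>F k in sequentially. q < b (r k)"
      by (rule order_tendstoD(2)[OF lim(1) pq(1)]) (rule order_tendstoD(1)[OF lim(2) pq(3)])
    then have "\<forall>\<^sub>F k in sequentially. a (r k) < p \<and> q < b (r k)" by (rule eventually_conj)
    then obtain N where N: "\<And>k. k \<ge> N \<Longrightarrow> a (r k) < p \<and> q < b (r k)"
      unfolding eventually_sequentially by blast
    have sub: "{p..q} \<subseteq> L (r k)" if "k \<ge> N" for k
      using N[OF that] inn[of "r k"] by auto
    have fi: "fin_int {p..q}" using defect_mono(1)[OF L(1) pq(2) sub[OF order_refl]] .
    have "best * measure \<mu> {p..q} - measure \<nu> {p..q} \<le> inverse (real (Suc k))" if "k \<ge> N" for k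
    proof -
      have "inverse (real (Suc (r k))) \<le> inverse (real (Suc k))"
        using strict_mono_imp_increasing[OF lr(2), of k] by (intro le_imp_inverse_le) auto
      then show ?thesis
        using defect_mono(2)[OF L(1) pq(2) sub[OF that]] defect[of "r k"] by linarith
    qed
    then have "best * measure \<mu> {p..q} - measure \<nu> {p..q} \<le> 0"
      by (intro LIMSEQ_le_const[OF LIMSEQ_inverse_real_of_nat]) auto
    then show ?thesis using best_bound[OF fi] fi by simp
  qed
  ultimately show ?thesis using range by (intro exI[of _ \<alpha>] exI[of _ \<beta>]) auto
qed

section \<open>Borel sets on which the two measures are proportional\<close>

definition good :: "real set \<Rightarrow> bool" where
  "good A \<longleftrightarrow> A \<in> sets borel \<and> A \<subseteq> {0..1} \<and>
     (\<forall>B\<in>sets borel. B \<subseteq> A \<longrightarrow> emeasure \<nu> B = ennreal best * emeasure \<mu> B)"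

lemma good_countable:
  assumes "countable A" "A \<subseteq> {0..1}" shows "good A"
proof -
  have "emeasure \<nu> B = ennreal best * emeasure \<mu> B" if "B \<subseteq> A" for B
  proof -
    have "countable B" "B \<subseteq> {0..1}" using that assms countable_subset by auto
    then show ?thesis using class_M_countable[OF mu] class_M_countable[OF nu] by (metis mult_zero_right null_setsD1)
  qed
  then show ?thesis using assms by (auto simp: good_def sets.countable)
qed

text \<open>Because \<open>good\<close> speaks of all Borel subsets, a subset of the union can be
  cut into disjoint pieces, each inside one \<open>A n\<close>, and countable additivity applies
  without any finiteness of \<mu>.\<close>

lemma good_UN_nat:
  fixes A :: "nat \<Rightarrow> real set"
  assumes "\<And>n. good (A n)" shows "good (\<Union>n. A n)"
proof -
  have A: "A n \<in> sets borel" "A n \<subseteq> {0..1}" for n using assms by (auto simp: good_def)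
  have "emeasure \<nu> B = ennreal best * emeasure \<mu> B" if B: "B \<in> sets borel" "B \<subseteq> (\<Union>n. A n)" for B
  proof -
    define E where "E n = B \<inter> disjointed A n" for n
    have E: "E n \<in> sets borel" "E n \<subseteq> A n" for n
      using A(1) B(1) disjointed_subset[of A n] sets.range_disjointed_sets[of A borel] by (auto simp: E_def)
    have un: "(\<Union>n. E n) = B" using B(2) UN_disjointed_eq[of A] by (auto simp: E_def)
    have dj: "disjoint_family E"
      using disjoint_family_disjointed[of A] by (fastforce simp: E_def disjoint_family_on_def)
    have "emeasure \<nu> B = (\<Sum>n. emeasure \<nu> (E n))"
      using suminf_emeasure[OF _ dj, of \<nu>] un E A(2) class_M_sets[OF nu] by force
    also have "\<dots> = (\<Sum>n. ennreal best * emeasure \<mu> (E n))"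
      using assms E unfolding good_def by (intro suminf_cong) blast
    also have "\<dots> = ennreal best * emeasure \<mu> B"
      unfolding ennreal_suminf_cmult using suminf_emeasure[OF _ dj, of \<mu>] un E A(2) class_M_sets[OF mu] by force
    finally show ?thesis .
  qed
  then show ?thesis using A unfolding good_def by blast
qed

lemma good_UN:
  assumes "countable K" "\<And>k. k \<in> K \<Longrightarrow> good (A k)" shows "good (\<Union>k\<in>K. A k)"
proof (cases "K = {}")
  case True then show ?thesis by (simp add: good_countable)
next
  case False
  then have "(\<Union>k\<in>K. A k) = (\<Union>n. A (from_nat_into K n))"
    using range_from_nat_into[OF False assms(1)] by (metis image_image)
  then show ?thesis using good_UN_nat assms(2) from_nat_into[OF False] by simp
qed

lemma good_Un: "good A \<Longrightarrow> good B \<Longrightarrow> good (A \<union> B)"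
  using good_UN[of "{A, B}" id] by auto

text \<open>A Borel subset of the image is itself the image of a Borel subset \<open>E\<close> of
  the part of \<open>A\<close> in the lap. Both measures of \<open>E\<close> are multiplied by the
  same \<open>lam\<close>, so their proportion survives.\<close>

lemma good_pimage:
  assumes A: "good A" and I: "I \<in> basic_intervals P"
  shows "good (pimage g (I \<inter> A))"
proof -
  have Ab: "A \<in> sets borel" using A by (simp add: good_def)
  have "pimage g (I \<inter> A) \<in> sets borel \<and> pimage g (I \<inter> A) \<subseteq> {0..1}"
    using pimage_borel[OF pw I Ab] by (auto simp: sets_restrict_space_iff)
  moreover have "emeasure \<nu> B = ennreal best * emeasure \<mu> B"
    if B: "B \<in> sets borel" "B \<subseteq> pimage g (I \<inter> A)" for B
  proof -
    define E where "E = ((\<lambda>x. the (g x)) -` B \<inter> I) \<inter> A"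
    have Ib: "I \<in> sets borel" using I by (simp add: basic_intervals_is_interval is_interval_borel)
    have "(\<lambda>x. the (g x)) \<in> borel_measurable (restrict_space borel I)"
      using pw I by (intro borel_measurable_continuous_on_restrict) (auto simp: pw_monotone_def)
    from measurable_sets[OF this B(1)] have "E \<in> sets borel"
      using Ib Ab by (auto simp: E_def space_restrict_space sets_restrict_space_iff)
    moreover have "E \<subseteq> I" "E \<subseteq> A" by (auto simp: E_def)
    moreover have "pimage g E = B"
      using B(2) pw_monotone_defined[OF pw I] by (fastforce simp: E_def pimage_iff)
    ultimately show ?thesis
      using scale_mu[OF I, of E] scale_nu[OF I, of E] A by (simp add: good_def mult_ac)
  qed
  ultimately show ?thesis by (simp add: good_def)
qed

text \<open>Finite Borel measures on the line are determined by their values on open rays. A ray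
  cuts \<open>{p..q}\<close> in the empty set, the whole interval or some \<open>{x..q}\<close>
  without its left endpoint, and that point is null for both measures.\<close>

lemma good_Icc:
  assumes "p \<le> q"
    and H: "\<And>x. p \<le> x \<Longrightarrow> x \<le> q \<Longrightarrow> fin_int {x..q} \<and> measure \<nu> {x..q} = best * measure \<mu> {x..q}"
  shows "good {p..q}"
proof -
  have fi: "fin_int {p..q}" using H assms(1) by simp
  note S = fin_int_sets(1,2)[OF fi]
  \<comment> \<open>Both measures are restricted to \<open>{p..q}\<close> and pushed forward to the
    Borel sets of the line, where the uniqueness theorem for rays can be used.\<close>
  define M where "M m = distr (restrict_space m {p..q}) borel (\<lambda>x. x)" for m :: "real measure"
  have eM: "emeasure (M m) B = emeasure m (B \<inter> {p..q})"
    if m: "m = \<mu> \<or> m = \<nu>" and B: "B \<in> sets borel" for m B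
  proof -
    have ms: "{p..q} \<in> sets m" using m S by auto
    have mm: "(\<lambda>x. x) \<in> restrict_space m {p..q} \<rightarrow>\<^sub>M borel"
      using m fi class_M_sets[OF mu] class_M_sets[OF nu] ms class_M_space[OF mu] class_M_space[OF nu]
      by (intro measurableI) (auto simp: sets_restrict_space_iff space_restrict_space fin_int_def)
    have "emeasure (M m) B = emeasure (restrict_space m {p..q}) (B \<inter> {p..q})"
      unfolding M_def using B m fi class_M_space[OF mu] class_M_space[OF nu]
      by (subst emeasure_distr[OF mm]) (auto simp: space_restrict_space fin_int_def Int_absorb1)
    also have "\<dots> = emeasure m (B \<inter> {p..q})"
      using ms by (intro emeasure_restrict_space) auto
    finally show ?thesis .
  qed
  have half: "emeasure \<nu> {x..q} = ennreal best * emeasure \<mu> {x..q}" if "p \<le> x" "x \<le> q" for x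
  proof -
    have "fin_int {x..q}" "measure \<nu> {x..q} = best * measure \<mu> {x..q}" using H that by auto
    then show ?thesis using fin_int_sets(3)[of "{x..q}"] best_nonneg
      by (simp add: nu.emeasure_eq_measure emeasure_eq_measure2 ennreal_mult)
  qed
  have ray: "emeasure \<nu> ({x<..} \<inter> {p..q}) = ennreal best * emeasure \<mu> ({x<..} \<inter> {p..q})" for x
  proof -
    consider "x < p" | "p \<le> x" "x \<le> q" | "q < x" by linarith
    then show ?thesis
    proof cases
      case 1
      then have "{x<..} \<inter> {p..q} = {p..q}" by auto
      then show ?thesis using half[of p] assms(1) by simp
    next
      case 2
      have x: "{x} \<in> null_sets m" if "m \<in> class_M" for m
        using 2 fi assms(1) by (intro class_M_countable[OF that]) (auto simp: fin_int_def)
      have eq: "{x<..} \<inter> {p..q} = {x..q} - {x}" using 2 by auto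
      have "fin_int {x..q}" using H 2 by auto
      then show ?thesis
        unfolding eq using half[OF 2] x[OF mu] x[OF nu] fin_int_sets(1,2)
        by (simp add: emeasure_Diff_null_set)
    next
      case 3
      then have "{x<..} \<inter> {p..q} = {}" by auto
      then show ?thesis by simp
    qed
  qed
  have eq: "M \<nu> = scale_measure (ennreal best) (M \<mu>)"
  proof (rule measure_eqI_lessThan)
    show "emeasure (M \<nu>) {x<..} < \<infinity>" for x
      by (simp add: eM nu.emeasure_finite less_top[symmetric])
    show "emeasure (M \<nu>) {x<..} = emeasure (scale_measure (ennreal best) (M \<mu>)) {x<..}" for x
      using ray by (simp add: eM)
  qed (simp_all add: M_def)
  have "emeasure \<nu> B = ennreal best * emeasure \<mu> B" if "B \<in> sets borel" "B \<subseteq> {p..q}" for B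
  proof -
    have "B \<inter> {p..q} = B" using that by auto
    then show ?thesis using eM[of \<nu> B] eM[of \<mu> B] that(1) eq by simp
  qed
  then show ?thesis using fi by (auto simp: good_def fin_int_def)
qed

section \<open>Spreading the proportionality by transitivity\<close>

lemma not_substantially_transitive:
  assumes fg: "eq_C f g" and f: "ran f \<subseteq> {0..1}" and inf: "emeasure \<mu> {0..1} = \<infinity>"
  shows "\<not> substantially_transitive f"
proof
  assume tr: "substantially_transitive f"
  obtain a b where ab: "0 \<le> a" "a < b" "b \<le> 1" and opt: "\<And>p q. a < p \<Longrightarrow> p \<le> q \<Longrightarrow> q < b \<Longrightarrow>
     fin_int {p..q} \<and> measure \<nu> {p..q} = best * measure \<mu> {p..q}"
    using optimal_interval by blast
  \<comment> \<open>Optimality is available only on closed intervals strictly inside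
    \<open>{a<..<b}\<close>; the open set is taken inside one of them.\<close>
  obtain p q where pq: "a < p" "p < q" "q < b" using ab(2) dense by metis
  define U where "U = {p<..<q}"
  have U0: "good {p..q}" using pq opt by (intro good_Icc) auto
  obtain D where D: "closed_countable D" "\<And>x. x \<in> {0..1} - D \<Longrightarrow> f x = g x"
    using fg by (auto simp: eq_C_def)
  \<comment> \<open>A good superset suffices, which avoids asking whether the image itself is Borel.
    The points of \<open>D\<close>, where \<open>f\<close> and \<open>g\<close> may differ, add only
    a countable image.\<close>
  have step: "\<exists>B. good B \<and> pimage f A \<subseteq> B" if A: "good A" for A
  proof (intro exI conjI)
    let ?B = "(\<Union>I\<in>basic_intervals P. pimage g (I \<inter> A)) \<union> pimage f D"
    have "countable D" using D by (simp add: closed_countable_def)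
    then have "good (pimage f D)"
      using f by (intro good_countable countable_pimage) (meson pimage_iff ranI subset_iff)+
    then show "good ?B"
      using good_pimage[OF A] countable_basic_intervals[OF cc] by (intro good_Un good_UN)
    show "pimage f A \<subseteq> ?B"
    proof
      fix y assume "y \<in> pimage f A"
      then obtain x where x: "x \<in> A" "f x = Some y" by (auto simp: pimage_iff)
      show "y \<in> ?B"
      proof (cases "x \<in> D")
        case True
        then show ?thesis using x by (auto simp: pimage_iff)
      next
        case False
        then have gx: "g x = Some y" using D(2)[of x] x A by (auto simp: good_def)
        then have "x \<in> {0..1} - P" using pw by (auto simp: pw_monotone_def)
        then obtain I where "I \<in> basic_intervals P" "x \<in> I" using Union_basic_intervals[of P] by blast
        then show ?thesis using x gx by (auto simp: pimage_iff)
      qed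
    qed
  qed
  have it: "\<exists>B. good B \<and> pimage (iterate f n) U \<subseteq> B" for n
  proof (induction n)
    case 0
    then show ?case using U0 by (intro exI[of _ "{p..q}"]) (auto simp: U_def pimage_iff)
  next
    case (Suc n)
    then obtain A where A: "good A" "pimage (iterate f n) U \<subseteq> A" by blast
    have "pimage (iterate f (Suc n)) U \<subseteq> pimage f A"
      using A(2) by (fastforce simp: pimage_iff map_comp_def split: option.splits)
    then show ?case using step[OF A(1)] by blast
  qed
  then obtain G where G: "\<And>n. good (G n)" "\<And>n. pimage (iterate f n) U \<subseteq> G n" by metis
  define R where "R = {0..1} - (\<Union>n. pimage (iterate f n) U)"
  have "openin (top_of_set {0..1}) U"
    using pq ab by (auto simp: U_def openin_open intro!: exI[of _ "{p<..<q}"])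
  moreover have "U \<noteq> {}" using pq by (simp add: U_def)
  ultimately have "countable R" using tr by (simp add: substantially_transitive_def R_def)
  then have "good R" by (intro good_countable) (auto simp: R_def)
  then have gd: "good (R \<union> (\<Union>n. G n))" using G(1) by (intro good_Un good_UN_nat)
  moreover have "{0..1} \<subseteq> R \<union> (\<Union>n. G n)" using G(2) by (auto simp: R_def)
  ultimately have "emeasure \<nu> {0..1} = ennreal best * emeasure \<mu> {0..1}"
    unfolding good_def by auto
  \<comment> \<open>Positivity of \<open>best\<close> matters: in \<open>ennreal\<close> the product
    of 0 and infinity is 0.\<close>
  then have "emeasure \<nu> {0..1} = \<infinity>" using inf best_pos by (simp add: ennreal_mult_top)
  then show False using nu.emeasure_finite by simp
qed

end

text \<open>For \<open>A\<close> inside one lap all other summands of the operator are measures of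
  the empty set, so the eigenvalue equation becomes a scaling law for a single branch. Passing from
  \<open>f\<close> to \<open>g\<close> changes the image only by a null set.\<close>

lemma conformal_on_lap:
  assumes f: "f \<in> class_C" and g: "eq_C f g" "pw_monotone g P" and m: "\<mu> \<in> class_M"
    and T: "T_op f \<mu> = scale_measure (ennreal lam) \<mu>"
    and I: "I \<in> basic_intervals P" and A: "A \<in> sets borel" "A \<subseteq> I"
  shows "emeasure \<mu> (pimage g A) = ennreal lam * emeasure \<mu> A"
proof -
  have adm: "admissible f P" using g by (auto simp: admissible_def)
  have AS: "A \<in> sets (restrict_space borel {0..1})"
    using A basic_intervals_subset[OF I] by (auto simp: sets_restrict_space_iff)
  have other: "J \<inter> A = {}" if "J \<in> basic_intervals P - {I}" for J
    using that A(2) basic_intervals_overlap[OF I, of J] by blast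
  have "ennreal lam * emeasure \<mu> A = (\<Sum>\<^sub>\<infinity>J\<in>basic_intervals P. emeasure \<mu> (pimage f (J \<inter> A)))"
    using emeasure_T_op[OF f m adm AS] by (simp add: T)
  also have "\<dots> = (\<Sum>\<^sub>\<infinity>J\<in>{I}. emeasure \<mu> (pimage f (J \<inter> A)))"
    using I other by (intro infsum_cong_neutral) (auto simp: pimage_def)
  also have "\<dots> = emeasure \<mu> (pimage g (I \<inter> A))"
    using pimage_eq_C[OF f m g I A(1)] by simp
  finally show ?thesis using A(2) by (simp add: Int_absorb1)
qed

theorem theorem4p5:
  fixes f :: "real \<rightharpoonup> real" and lam \<delta> :: real
    and \<mu> :: "real measure" and P :: "real set"
  assumes "f \<in> class_C"
    and "substantially_transitive f"
    and "lam > 2"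
    and "\<delta> > 0"
    and "\<mu> \<in> class_M"
    and "emeasure \<mu> {0..1} = \<infinity>"
    and "admissible f P"
    and "T_op f \<mu> = scale_measure (ennreal lam) \<mu>"
    and "\<forall>I \<in> basic_intervals P. ennreal \<delta> \<le> emeasure \<mu> I \<and> emeasure \<mu> I < \<infinity>"
  shows "\<not> (\<exists>\<nu>. \<nu> \<in> class_M \<and> prob_space \<nu> \<and>
                 T_op f \<nu> = scale_measure (ennreal lam) \<nu>)"
proof
  assume "\<exists>\<nu>. \<nu> \<in> class_M \<and> prob_space \<nu> \<and> T_op f \<nu> = scale_measure (ennreal lam) \<nu>"
  then obtain \<nu> where \<nu>: "\<nu> \<in> class_M" "prob_space \<nu>"
    "T_op f \<nu> = scale_measure (ennreal lam) \<nu>" by blast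
  obtain g where g: "eq_C f g" "pw_monotone g P" using assms(7) by (auto simp: admissible_def)
  interpret lap_expanding g P \<mu> \<nu> lam \<delta>
    using assms \<nu> g conformal_on_lap[OF assms(1) g assms(5,8)] conformal_on_lap[OF assms(1) g \<nu>(1,3)]
    by (auto simp: lap_expanding_def)
  have "ran f \<subseteq> {0..1}" using assms(1) by (auto simp: class_C_def pw_monotone_def)
  then show False using not_substantially_transitive[OF g(1)] assms(2,6) by blast
qed

end
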